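(* Let $L$ be a $BL$-algebra, let $\alpha,\beta\in(0,1]$ with $\alpha<\beta$, and let $F:L\to[0,1]$ be a fuzzy set. Then $F$ is a fuzzy implicative filter with thresholds $(\alpha,\beta]$ of $L$ if and only if for every $t$ with $\alpha<t\le\beta$ for which $U(F;t)=\{x\in L\mid F(x)\ge t\}$ is non-empty, $U(F;t)$ is an implicative filter of $L$.
   Context: A $BL$-algebra is an algebra $(L,\le,\wedge,\vee,\odot,\rightarrow,0,1)$ that is a bounded lattice (least element $0$, greatest element $1$) such that $(L,\odot,1)$ is a commutative monoid, $z\le x\rightarrow y$ iff $x\odot z\le y$, $x\wedge y=x\odot(x\rightarrow y)$, and $(x\rightarrow y)\vee(y\rightarrow x)=1$, for all $x,y,z\in L$. Write $x'=x\rightarrow 0$. A filter of $L$ is a non-empty subset $A\subseteq L$ with $1\in A$ such that $x\in A$ and $x\rightarrow y\in A$ imply $y\in A$; it is implicative if $x\rightarrow(z'\rightarrow y)\in A$ and $y\rightarrow z\in A$ imply $x\rightarrow z\in A$ for all $x,y,z$. A fuzzy set $F$ is a fuzzy implicative filter with thresholds $(\alpha,\beta]$ of $L$ if for all $x,y,z\in L$: $\max\{F(x\odot y),\alpha\}\ge\min\{F(x),F(y),\beta\}$; whenever $x\le y$, $\max\{F(y),\alpha\}\ge\min\{F(x),\beta\}$; and $\max\{F(x\rightarrow z),\alpha\}\ge\min\{F(x\rightarrow(z'\rightarrow y)),F(y\rightarrow z),\beta\}$. *)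

theory Defs
  imports Complex_Main
begin

text \<open>
  The carrier of a BL-algebra is the whole type. The lattice bounds 0 and 1 are \<^term>\<open>bot\<close>
  and \<^term>\<open>top\<close>; the latter is identified with the monoid unit \<^term>\<open>1\<close>.
  There is no constant \<^term>\<open>0\<close> in the class. The product is written \<open>*\<close>.
\<close>

class bl_algebra = bounded_lattice + comm_monoid_mult +
  fixes residuum :: "'a \<Rightarrow> 'a \<Rightarrow> 'a"  (infixr "\<leadsto>" 60)
  assumes one_eq_top: "1 = top"
    and residuation: "z \<le> (x \<leadsto> y) \<longleftrightarrow> x * z \<le> y"
    and divisibility: "inf x y = x * (x \<leadsto> y)"
    and prelinearity: "sup (x \<leadsto> y) (y \<leadsto> x) = 1"

definition bl_neg :: "'a::bl_algebra \<Rightarrow> 'a" where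
  "bl_neg x = (x \<leadsto> bot)"

definition bl_filter :: "'a::bl_algebra set \<Rightarrow> bool" where
  "bl_filter A \<longleftrightarrow>
     A \<noteq> {} \<and> 1 \<in> A \<and> (\<forall>x y. x \<in> A \<and> (x \<leadsto> y) \<in> A \<longrightarrow> y \<in> A)"

definition implicative_filter :: "'a::bl_algebra set \<Rightarrow> bool" where
  "implicative_filter A \<longleftrightarrow>
     bl_filter A \<and>
     (\<forall>x y z. (x \<leadsto> (bl_neg z \<leadsto> y)) \<in> A \<and> (y \<leadsto> z) \<in> A \<longrightarrow> (x \<leadsto> z) \<in> A)"

definition fuzzy_set :: "('a \<Rightarrow> real) \<Rightarrow> bool" where
  "fuzzy_set F \<longleftrightarrow> (\<forall>x. F x \<in> {0..1})"

definition level_set :: "('a \<Rightarrow> real) \<Rightarrow> real \<Rightarrow> 'a set" where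
  "level_set F t = {x. F x \<ge> t}"

definition fuzzy_implicative_filter :: "real \<Rightarrow> real \<Rightarrow> ('a::bl_algebra \<Rightarrow> real) \<Rightarrow> bool" where
  "fuzzy_implicative_filter \<alpha> \<beta> F \<longleftrightarrow>
     fuzzy_set F \<and>
     (\<forall>x y. max (F (x * y)) \<alpha> \<ge> min (F x) (min (F y) \<beta>)) \<and>
     (\<forall>x y. x \<le> y \<longrightarrow> max (F y) \<alpha> \<ge> min (F x) \<beta>) \<and>
     (\<forall>x y z. max (F (x \<leadsto> z)) \<alpha>
        \<ge> min (F (x \<leadsto> (bl_neg z \<leadsto> y))) (min (F (y \<leadsto> z)) \<beta>))"

end

theory Submission
  imports Defs
begin

text \<open>
  Each fuzzy inequality \<open>min m \<beta> \<le> max a \<alpha>\<close> says exactly that every threshold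
  \<open>t\<close> in \<open>(\<alpha>, \<beta>]\<close> below \<open>m\<close> is also below \<open>a\<close>. Hence the fuzzy
  conditions hold iff every nonempty level set satisfies the corresponding crisp closure conditions, and a
  nonempty set is a filter iff it is closed under products and upward closed.
\<close>

lemma min_le_max_iff_thresholds:
  fixes m a \<alpha> \<beta> :: "'b::linorder"
  shows "min m \<beta> \<le> max a \<alpha> \<longleftrightarrow> (\<forall>t. \<alpha> < t \<and> t \<le> \<beta> \<longrightarrow> t \<le> m \<longrightarrow> t \<le> a)"
proof
  assume "min m \<beta> \<le> max a \<alpha>"
  then show "\<forall>t. \<alpha> < t \<and> t \<le> \<beta> \<longrightarrow> t \<le> m \<longrightarrow> t \<le> a"
    by (auto simp: le_max_iff_disj min_le_iff_disj)
next
  assume "\<forall>t. \<alpha> < t \<and> t \<le> \<beta> \<longrightarrow> t \<le> m \<longrightarrow> t \<le> a"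
  then show "min m \<beta> \<le> max a \<alpha>"
    \<comment> \<open>If \<open>min m \<beta>\<close> exceeds \<alpha>, it is itself an admissible
      threshold below \<open>m\<close>.\<close>
    by (auto simp: le_max_iff_disj not_less[symmetric] dest: spec[of _ "min m \<beta>"])
qed

lemma residuum_eq_one_iff:
  fixes x y :: "'a::bl_algebra"
  shows "(x \<leadsto> y) = 1 \<longleftrightarrow> x \<le> y"
  by (metis residuation mult.right_neutral one_eq_top top_unique)

text \<open>Trades modus ponens for the two closure conditions that the first two fuzzy axioms
  express on level sets.\<close>

lemma bl_filter_iff:
  fixes A :: "'a::bl_algebra set"
  shows "bl_filter A \<longleftrightarrow>
    A \<noteq> {} \<and> (\<forall>x\<in>A. \<forall>y\<in>A. x * y \<in> A) \<and> (\<forall>x\<in>A. \<forall>y. x \<le> y \<longrightarrow> y \<in> A)"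
proof
  assume A: "bl_filter A"
  have up: "y \<in> A" if "x \<in> A" "x \<le> y" for x y
    \<comment> \<open>Here \<open>x \<leadsto> y\<close> equals 1, so modus ponens applies.\<close>
    using A that unfolding bl_filter_def by (metis residuum_eq_one_iff)
  have "x * y \<in> A" if "x \<in> A" "y \<in> A" for x y
  proof -
    have "y \<le> (x \<leadsto> x * y)"
      by (simp add: residuation)
    with that up have "(x \<leadsto> x * y) \<in> A"
      by blast
    with A that show ?thesis
      unfolding bl_filter_def by blast
  qed
  with A up show "A \<noteq> {} \<and> (\<forall>x\<in>A. \<forall>y\<in>A. x * y \<in> A) \<and> (\<forall>x\<in>A. \<forall>y. x \<le> y \<longrightarrow> y \<in> A)"
    unfolding bl_filter_def by blast
next
  assume A: "A \<noteq> {} \<and> (\<forall>x\<in>A. \<forall>y\<in>A. x * y \<in> A) \<and> (\<forall>x\<in>A. \<forall>y. x \<le> y \<longrightarrow> y \<in> A)"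
  then have "1 \<in> A"
    by (metis all_not_in_conv one_eq_top top_greatest)
  moreover have "y \<in> A" if "x \<in> A" "(x \<leadsto> y) \<in> A" for x y
    \<comment> \<open>Residuation at \<open>z = (x \<leadsto> y)\<close> gives
      \<open>x * (x \<leadsto> y) \<le> y\<close>; product and upward closure finish.\<close>
    using A that by (metis order_refl residuation)
  ultimately show "bl_filter A"
    using A unfolding bl_filter_def by blast
qed

lemma fuzzy_implicative_filter_iff_thresholds:
  "fuzzy_implicative_filter \<alpha> \<beta> F \<longleftrightarrow>
    fuzzy_set F \<and>
    (\<forall>t. \<alpha> < t \<and> t \<le> \<beta> \<longrightarrow>
      (\<forall>x y. t \<le> F x \<and> t \<le> F y \<longrightarrow> t \<le> F (x * y)) \<and>
      (\<forall>x y. x \<le> y \<longrightarrow> t \<le> F x \<longrightarrow> t \<le> F y) \<and>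
      (\<forall>x y z. t \<le> F (x \<leadsto> (bl_neg z \<leadsto> y)) \<and> t \<le> F (y \<leadsto> z) \<longrightarrow> t \<le> F (x \<leadsto> z)))"
  \<comment> \<open>Reassociation isolates \<beta> as the last argument of \<open>min\<close>, the
    shape that \<open>min_le_max_iff_thresholds\<close> requires.\<close>
  unfolding fuzzy_implicative_filter_def min.assoc[symmetric] min_le_max_iff_thresholds
    min.bounded_iff
  by iprover

text \<open>Every closure condition assumes some member of the level set, so all three are vacuous
  when it is empty.\<close>

lemma implicative_filter_level_set_iff:
  "(level_set F t \<noteq> {} \<longrightarrow> implicative_filter (level_set F t)) \<longleftrightarrow>
    (\<forall>x y. t \<le> F x \<and> t \<le> F y \<longrightarrow> t \<le> F (x * y)) \<and>
    (\<forall>x y. x \<le> y \<longrightarrow> t \<le> F x \<longrightarrow> t \<le> F y) \<and>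
    (\<forall>x y z. t \<le> F (x \<leadsto> (bl_neg z \<leadsto> y)) \<and> t \<le> F (y \<leadsto> z) \<longrightarrow> t \<le> F (x \<leadsto> z))"
proof (cases "level_set F t = {}")
  case True
  then have "\<not> t \<le> F x" for x
    unfolding level_set_def by blast
  with True show ?thesis
    by simp
next
  case False
  then show ?thesis
    unfolding implicative_filter_def bl_filter_iff
    by (simp add: level_set_def Ball_def imp_conjL) iprover
qed

theorem theorem3p1p7:
  fixes F :: "'a::bl_algebra \<Rightarrow> real" and \<alpha> \<beta> :: real
  assumes "\<alpha> \<in> {0<..1}" and "\<beta> \<in> {0<..1}" and "\<alpha> < \<beta>"
    and "fuzzy_set F"
  shows "fuzzy_implicative_filter \<alpha> \<beta> F \<longleftrightarrow>
    (\<forall>t. \<alpha> < t \<and> t \<le> \<beta> \<and> level_set F t \<noteq> {} \<longrightarrow> implicative_filter (level_set F t))"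
  using \<open>fuzzy_set F\<close>
  \<comment> \<open>Currying by \<open>imp_conjL\<close> exposes the implication from nonemptiness
    as a left-hand side of \<open>implicative_filter_level_set_iff\<close>.\<close>
  by (simp only: fuzzy_implicative_filter_iff_thresholds implicative_filter_level_set_iff
      imp_conjL simp_thms flip: conj_assoc)

end
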